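(* Let $g\ge4$ be an even integer. The only primitive number $m$ with $o_g(m)=1$ is $m=g-1$. There are no primitive numbers $m$ with $o_g(m)=2$ or $o_g(m)=3$. If $g-1$ is not divisible by $3$, there are no primitive numbers $m$ with $o_g(m)=4$ or $o_g(m)=5$. If $g-1$ is divisible by $3$, then there is exactly one primitive number of order $4$, namely $\frac{g^4-1}{3}$, and exactly one primitive number of order $5$, namely $\frac{g^5-1}{3}$.
   Context: Fix an even integer $g\ge4$. For an odd integer $m\ge1$, an extreme cycle for the digit set $\{0,m\}$ is a finite set of distinct integers $\{x_0,\dots,x_{r-1}\}$ together with digits $l_0,\dots,l_{r-1}\in\{0,m\}$ such that $x_{j+1}=(x_j+l_j)/g$ for $0\le j\le r-2$ and $x_0=(x_{r-1}+l_{r-1})/g$. The cycle $\{0\}$ (with digit $0$) is the trivial extreme cycle. The odd number $m$ is complete if the only extreme cycle for $\{0,m\}$ is the trivial one, and incomplete otherwise. An odd number $m$ is primitive if it is incomplete and every proper divisor of $m$ is complete (primitive numbers are coprime to $g$). For $m$ coprime to $g$, $o_g(m)$ (the order of $m$) denotes the order of $g$ in the multiplicative group $U(\mathbb{Z}_m)$. *)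

theory Defs
  imports Complex_Main "HOL-Number_Theory.Number_Theory"
begin

(* The points x_0, ..., x_{r-1} and digits l_0, ..., l_{r-1} are given as lists
   of the same length r >= 1. Division is division in the reals, so the condition
   includes that each quotient is an integer. *)
definition extreme_cycle :: "nat \<Rightarrow> nat \<Rightarrow> int list \<Rightarrow> int list \<Rightarrow> bool" where
  "extreme_cycle g m xs ls \<longleftrightarrow>
     xs \<noteq> [] \<and> length ls = length xs \<and> distinct xs \<and> set ls \<subseteq> {0, int m} \<and>
     (\<forall>j. Suc j < length xs \<longrightarrow>
        real_of_int (xs ! Suc j) = real_of_int (xs ! j + ls ! j) / real g) \<and>
     real_of_int (xs ! 0) =
       real_of_int (xs ! (length xs - 1) + ls ! (length xs - 1)) / real g"

definition complete_number :: "nat \<Rightarrow> nat \<Rightarrow> bool" where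
  "complete_number g m \<longleftrightarrow>
     (\<forall>xs ls. extreme_cycle g m xs ls \<longleftrightarrow> xs = [0] \<and> ls = [0])"

definition incomplete_number :: "nat \<Rightarrow> nat \<Rightarrow> bool" where
  "incomplete_number g m \<longleftrightarrow> \<not> complete_number g m"

definition primitive_number :: "nat \<Rightarrow> nat \<Rightarrow> bool" where
  "primitive_number g m \<longleftrightarrow>
     odd m \<and> incomplete_number g m \<and>
     (\<forall>d. d dvd m \<and> d \<noteq> m \<longrightarrow> complete_number g d)"

lemma trivial_extreme_cycle: "extreme_cycle g m [0] [0]"
  by (simp add: extreme_cycle_def)

(* In the library, "ord m g" is 0 when m and g are not coprime, so
   "ord m g = k" with k >= 1 entails that m is coprime to g. *)

end

theory Submission
  imports Defs
begin

text \<open>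
  Iterating \<open>g x\<^sub>j\<^sub>+\<^sub>1 = x\<^sub>j + l\<^sub>j\<close> over \<open>k\<close> steps, where \<open>m\<close> divides \<open>g ^ k - 1\<close>, gives
  \<open>(g ^ k - 1) x\<^sub>0 = m a\<close> with \<open>a\<close> a sum of distinct powers \<open>g ^ i\<close>, \<open>i < k\<close>. So an incomplete
  \<open>m\<close> has a cofactor \<open>D = (g ^ k - 1) / m\<close> dividing a nonzero such \<open>a\<close>. For \<open>k \<le> 5\<close>, up to
  cyclic rotation of the digits, a Bezout identity for each \<open>a\<close> shows that \<open>D\<close> divides
  the repunit \<open>1 + g + \<dots> + g ^ (k - 1)\<close> or divides \<open>3\<close>. In the first case the incomplete number
  \<open>g - 1\<close> divides \<open>m\<close>; the second case needs \<open>3 dvd g - 1\<close> and \<open>k \<ge> 4\<close>, and there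
  \<open>3 dvd 1 + g + g\<^sup>2\<close> yields a nontrivial cycle for \<open>(g ^ k - 1) / 3\<close>.
\<close>

text \<open>Divisibilities are certified below by explicit coefficients \<open>u\<close> and
  \<open>v\<close>; what remains is a polynomial identity in \<open>g\<close>.\<close>

lemma dvd_combination:
  fixes D a b c u v :: int
  assumes "D dvd a" "D dvd b" "c = u * a + v * b"
  shows "D dvd c"
  using assms by simp

section \<open>Extreme cycles as integer recurrences\<close>

lemma real_eq_divide_iff:
  assumes "g > 0"
  shows "real_of_int x = real_of_int y / real g \<longleftrightarrow> int g * x = y"
proof -
  have "real_of_int x = real_of_int y / real g \<longleftrightarrow> real_of_int (int g * x) = real_of_int y"
    using assms by (simp add: field_simps)
  then show ?thesis by (simp only: of_int_eq_iff)
qed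

lemma extreme_cycle_iff:
  assumes "g > 0"
  shows "extreme_cycle g m xs ls \<longleftrightarrow>
     xs \<noteq> [] \<and> length ls = length xs \<and> distinct xs \<and> set ls \<subseteq> {0, int m} \<and>
     (\<forall>j. Suc j < length xs \<longrightarrow> int g * xs ! Suc j = xs ! j + ls ! j) \<and>
     int g * xs ! 0 = xs ! (length xs - 1) + ls ! (length xs - 1)"
  unfolding extreme_cycle_def using assms by (simp only: real_eq_divide_iff)

text \<open>Indices taken modulo the length absorb the wrap-around equation, so the recurrence can
  be iterated any number of times.\<close>

lemma extreme_cycle_cyclic_step:
  assumes "g > 0" and "extreme_cycle g m xs ls"
  shows "int g * xs ! (Suc j mod length xs) = xs ! (j mod length xs) + ls ! (j mod length xs)"
proof -
  let ?r = "length xs"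
  have "?r > 0"
    and st: "\<And>j. Suc j < ?r \<Longrightarrow> int g * xs ! Suc j = xs ! j + ls ! j"
    and wrap: "int g * xs ! 0 = xs ! (?r - 1) + ls ! (?r - 1)"
    using assms by (auto simp: extreme_cycle_iff)
  show ?thesis
  proof (cases "Suc (j mod ?r) = ?r")
    case True
    then have "Suc j mod ?r = 0" "j mod ?r = ?r - 1" by (simp_all add: mod_Suc)
    then show ?thesis using wrap by simp
  next
    case False
    moreover have "j mod ?r < ?r" using \<open>?r > 0\<close> by simp
    ultimately show ?thesis using st[of "j mod ?r"] by (simp add: mod_Suc)
  qed
qed

lemma extreme_cycle_digit:
  assumes "extreme_cycle g m xs ls" and "j < length xs"
  shows "ls ! j \<in> {0, int m}"
  using assms unfolding extreme_cycle_def by (metis nth_mem subsetD)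

text \<open>Every point \<open>x\<close> has a predecessor \<open>y\<close> in the cycle with
  \<open>g x = y + l\<close>. At the minimum \<open>a\<close> this gives \<open>g a \<ge> a\<close>,
  at the maximum \<open>b\<close> it gives \<open>g b \<le> b + m\<close>.\<close>

lemma extreme_cycle_bounds:
  assumes "g > 1" and "extreme_cycle g m xs ls" and "x \<in> set xs"
  shows "0 \<le> x" and "(int g - 1) * x \<le> int m"
proof -
  let ?r = "length xs"
  have ne: "xs \<noteq> []" using assms by (simp add: extreme_cycle_iff)
  have pred: "\<exists>y\<in>set xs. \<exists>l. 0 \<le> l \<and> l \<le> int m \<and> int g * x = y + l" if x: "x \<in> set xs" for x
  proof -
    obtain i where i: "i < ?r" "xs ! i = x" using x by (auto simp: in_set_conv_nth)
    \<comment> \<open>The cyclic predecessor of \<open>i\<close>; adding \<open>?r\<close> first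
      keeps the subtraction on naturals exact at \<open>i = 0\<close>.\<close>
    define j where "j = (i + ?r - 1) mod ?r"
    have "Suc (i + ?r - 1) = i + ?r" using i(1) by linarith
    then have "Suc (i + ?r - 1) mod ?r = i" using i(1) by simp
    then have "int g * x = xs ! j + ls ! j"
      using extreme_cycle_cyclic_step[of g m xs ls "i + ?r - 1"] assms(1,2) i(2) by (simp add: j_def)
    moreover have "j < ?r" using ne by (simp add: j_def)
    moreover from this have "ls ! j \<in> {0, int m}" by (rule extreme_cycle_digit[OF assms(2)])
    then have "0 \<le> ls ! j \<and> ls ! j \<le> int m" by auto
    ultimately show ?thesis using nth_mem[of j xs] by blast
  qed
  let ?a = "Min (set xs)" and ?b = "Max (set xs)"
  have fin: "finite (set xs)" "set xs \<noteq> {}" using ne by auto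
  obtain y l where y: "y \<in> set xs" "0 \<le> l" "int g * ?a = y + l"
    using pred[of ?a] fin by auto
  then have "?a \<le> int g * ?a" using Min_le[OF fin(1), of y] by linarith
  then have "0 \<le> (int g - 1) * ?a" by (simp add: algebra_simps)
  then have "0 \<le> ?a" using assms(1) by (simp add: zero_le_mult_iff)
  then show "0 \<le> x" using Min_le[OF fin(1) assms(3)] by linarith
  obtain y l where y: "y \<in> set xs" "l \<le> int m" "int g * ?b = y + l"
    using pred[of ?b] fin by auto
  then have "int g * ?b \<le> ?b + int m" using Max_ge[OF fin(1), of y] by linarith
  then have "(int g - 1) * ?b \<le> int m" by (simp add: algebra_simps)
  moreover have "(int g - 1) * x \<le> (int g - 1) * ?b"
    using Max_ge[OF fin(1) assms(3)] assms(1) by (intro mult_left_mono) auto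
  ultimately show "(int g - 1) * x \<le> int m" by linarith
qed

text \<open>If all points were 0, distinctness would leave a single point, whose digit is then 0 as
  well: the trivial cycle.\<close>

lemma incomplete_imp_nonzero_point:
  assumes "g > 0" and "incomplete_number g m"
  obtains xs ls where "extreme_cycle g m xs ls" and "\<exists>j < length xs. xs ! j \<noteq> 0"
proof -
  obtain xs ls where c: "extreme_cycle g m xs ls" and nt: "\<not> (xs = [0] \<and> ls = [0])"
    using assms(2) trivial_extreme_cycle
    unfolding incomplete_number_def complete_number_def by blast
  have "\<exists>j < length xs. xs ! j \<noteq> 0"
  proof (rule ccontr)
    assume "\<not> ?thesis"
    then have z: "\<And>j. j < length xs \<Longrightarrow> xs ! j = 0" by blast
    have f: "xs \<noteq> []" "length ls = length xs" "distinct xs"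
      "int g * xs ! 0 = xs ! (length xs - 1) + ls ! (length xs - 1)"
      using c assms(1) by (auto simp: extreme_cycle_iff)
    have "length xs = 1"
    proof (rule ccontr)
      assume "length xs \<noteq> 1"
      then have "1 < length xs" using f(1) by (cases xs) auto
      then have "xs ! 0 = xs ! 1" "0 < length xs" using z[of 0] z[of 1] f(1) by simp_all
      then show False using f(3) \<open>1 < length xs\<close> nth_eq_iff_index_eq[of xs 0 1] by simp
    qed
    then obtain x l where "xs = [x]" "ls = [l]"
      using f(2) by (metis One_nat_def length_0_conv length_Suc_conv)
    then show False using z[of 0] f(4) nt by simp
  qed
  then show ?thesis using c that by blast
qed

text \<open>Multiplication by \<open>g\<close> runs the cycle backwards modulo \<open>m\<close>, and the points are
  too small to be congruent without being equal; so \<open>k\<close> steps close up.\<close>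

lemma incomplete_imp_dvd_digit_sum:
  assumes g: "g \<ge> 3" and m: "m > 0" and k: "0 < k" and dv: "int m dvd int g ^ k - 1"
    and inc: "incomplete_number g m"
  obtains S where "S \<subseteq> {..<k}" "S \<noteq> {}" "int g ^ k - 1 dvd int m * (\<Sum>i\<in>S. int g ^ i)"
proof -
  obtain xs ls where c: "extreme_cycle g m xs ls" and "\<exists>j < length xs. xs ! j \<noteq> 0"
    using incomplete_imp_nonzero_point[OF _ inc] g by auto
  then obtain s where s: "s < length xs" "xs ! s \<noteq> 0" by blast
  let ?r = "length xs"
  \<comment> \<open>The cycle is reindexed to start at a nonzero point, which later forces
    \<open>S\<close> to be nonempty.\<close>
  define X where "X j = xs ! ((s + j) mod ?r)" for j
  define L where "L j = ls ! ((s + j) mod ?r)" for j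
  have "?r > 0" using s(1) by linarith
  then have L: "L j \<in> {0, int m}" for j
    unfolding L_def by (intro extreme_cycle_digit[OF c]) simp
  have step: "int g * X (Suc j) = X j + L j" for j
    using extreme_cycle_cyclic_step[OF _ c, of "s + j"] g by (simp add: X_def L_def)
  have tel: "int g ^ n * X n = X 0 + (\<Sum>i<n. int g ^ i * L i)" for n
  proof (induction n)
    case (Suc n)
    have "int g ^ Suc n * X (Suc n) = int g ^ n * (int g * X (Suc n))" by simp
    also have "\<dots> = int g ^ n * X n + int g ^ n * L n" by (simp add: step algebra_simps)
    finally show ?case using Suc by simp
  qed simp
  define S where "S = {i. i < k \<and> L i \<noteq> 0}"
  have "(\<Sum>i<k. int g ^ i * L i) = (\<Sum>i\<in>S. int g ^ i * L i)"
    by (rule sum.mono_neutral_right) (auto simp: S_def)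
  also have "\<dots> = (\<Sum>i\<in>S. int m * int g ^ i)"
    using L by (intro sum.cong) (auto simp: S_def)
  finally have sumL: "(\<Sum>i<k. int g ^ i * L i) = int m * (\<Sum>i\<in>S. int g ^ i)"
    by (simp add: sum_distrib_left)
  \<comment> \<open>Since \<open>g - 1 \<ge> 2\<close>, all points lie between 0 and
    \<open>m / 2\<close>, so two of them that are congruent modulo \<open>m\<close>
    coincide.\<close>
  have X: "0 \<le> X j" "2 * X j \<le> int m" for j
  proof -
    have "X j \<in> set xs" unfolding X_def using \<open>?r > 0\<close> by (intro nth_mem) simp
    note b = extreme_cycle_bounds[OF _ c this]
    show "0 \<le> X j" using b(1) g by simp
    then have "2 * X j \<le> (int g - 1) * X j" using g by (intro mult_right_mono) auto
    then show "2 * X j \<le> int m" using b(2) g by linarith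
  qed
  have "int m dvd X k - X 0"
    by (rule dvd_combination[OF dvd_refl dv, where u = "\<Sum>i\<in>S. int g ^ i" and v = "- X k"])
      (use tel[of k] sumL in \<open>simp add: algebra_simps\<close>)
  moreover have "\<bar>X k - X 0\<bar> < int m" using X[of k] X[of 0] m by linarith
  ultimately have "X k = X 0" by (metis dvd_imp_le_int abs_of_nat eq_iff_diff_eq_0 linorder_not_le)
  then have eq: "(int g ^ k - 1) * X 0 = int m * (\<Sum>i\<in>S. int g ^ i)"
    using tel[of k] sumL by (simp add: algebra_simps)
  have "X 0 \<noteq> 0" using s by (simp add: X_def)
  have "S \<noteq> {}"
  proof
    assume "S = {}"
    then have "int g ^ k = 1" using eq \<open>X 0 \<noteq> 0\<close> by simp
    moreover have "1 < int g ^ k" using g k by (intro one_less_power) auto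
    ultimately show False by simp
  qed
  moreover have "S \<subseteq> {..<k}" by (auto simp: S_def)
  ultimately show ?thesis using that eq by (metis dvd_triv_left)
qed

section \<open>Divisors of digit sums with at most five digits\<close>

lemma dvd_three_and_pred:
  fixes D g :: int
  assumes "D dvd 3" "D dvd g - 1"
  shows "D dvd 1 \<or> D dvd 3 \<and> 3 dvd g - 1"
proof (cases "3 dvd D")
  case True
  then show ?thesis using assms dvd_trans by blast
next
  case False
  have "prime (3::int)" by simp
  then have "coprime 3 D" using False by (rule prime_imp_coprime)
  then have "coprime D 3" by (simp add: coprime_commute)
  then show ?thesis using coprime_absorb_left[OF assms(1)] by simp
qed

lemma odd_dvd_power_2_imp_unit:
  fixes D :: int
  assumes "odd D" "D dvd 2 ^ n"
  shows "D dvd 1"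
proof -
  have "coprime D (2 ^ n)" using assms(1) by simp
  then show ?thesis using coprime_absorb_left[OF assms(2)] by simp
qed

text \<open>Multiplication by \<open>g\<close> modulo \<open>g ^ 3 - 1\<close> rotates the digits
  \<open>(a, b, c)\<close>, so one pattern per rotation class suffices: 100, 110, 111. The first
  makes \<open>D\<close> a unit, the last is the repunit. For 110,
  \<open>(1 + g) (1 - g + g ^ 2) = 2 + (g ^ 3 - 1)\<close> and \<open>D\<close> is odd.\<close>

lemma dvd_digit_sum_3:
  fixes D g :: int and a b c :: bool
  assumes "even g" and z: "D dvd g ^ 3 - 1"
    and nz: "a \<or> b \<or> c"
    and dv: "D dvd of_bool a + of_bool b * g + of_bool c * g ^ 2"
  shows "D dvd 1 + g + g ^ 2"
proof -
  have "odd (g ^ 3 - 1)" using \<open>even g\<close> by simp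
  then have "odd D" using z dvd_trans by blast
  define P where "P a b c \<longleftrightarrow> D dvd of_bool a + of_bool b * g + of_bool c * g ^ 2" for a b c
  have rot: "P c a b" if "P a b c" for a b c
    unfolding P_def
    by (rule dvd_combination[OF that[unfolded P_def] z, where u = g and v = "- of_bool c"])
      (simp add: algebra_simps eval_nat_numeral)
  have 1: ?thesis if "P True False False"
    using that by (simp add: P_def unit_imp_dvd)
  have 2: ?thesis if "P True True False"
  proof -
    have "D dvd 2 ^ 1"
      by (rule dvd_combination[OF that[unfolded P_def] z, where u = "1 - g + g ^ 2" and v = "- 1"])
        (simp add: algebra_simps eval_nat_numeral)
    then show ?thesis using odd_dvd_power_2_imp_unit[OF \<open>odd D\<close>] by blast
  qed
  have 3: ?thesis if "P True True True" using that by (simp add: P_def)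
  have r0: "P a b c" using dv by (simp add: P_def)
  note r1 = rot[OF r0]
  note r2 = rot[OF r1]
  show ?thesis
  proof (rule ccontr)
    assume contra: "\<not> ?thesis"
    show False using contra nz 1 2 3 r0 r1 r2
      by (cases a; cases b; cases c; simp)
  qed
qed

text \<open>Up to rotation the patterns are 1000, 1100, 1010, 1110, 1111. The repunit factors as
  \<open>(1 + g) (1 + g ^ 2)\<close>, which settles 1100 and 1010. For 1110, \<open>D\<close>
  divides \<open>g - 1\<close>, modulo which the sum is its number of terms, 3.\<close>

lemma dvd_digit_sum_4:
  fixes D g :: int and a b c d :: bool
  assumes z: "D dvd g ^ 4 - 1"
    and nz: "a \<or> b \<or> c \<or> d"
    and dv: "D dvd of_bool a + of_bool b * g + of_bool c * g ^ 2 + of_bool d * g ^ 3"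
  shows "D dvd 1 + g + g ^ 2 + g ^ 3 \<or> D dvd 3 \<and> 3 dvd g - 1"
proof -
  define P where "P a b c d \<longleftrightarrow> D dvd of_bool a + of_bool b * g + of_bool c * g ^ 2 + of_bool d * g ^ 3"
    for a b c d
  have rot: "P d a b c" if "P a b c d" for a b c d
    unfolding P_def
    by (rule dvd_combination[OF that[unfolded P_def] z, where u = g and v = "- of_bool d"])
      (simp add: algebra_simps eval_nat_numeral)
  have 1: ?thesis if "P True False False False"
    using that by (simp add: P_def unit_imp_dvd)
  have 2: ?thesis if "P True True False False"
  proof -
    have "D dvd 1 + g + g ^ 2 + g ^ 3"
      by (rule dvd_combination[OF that[unfolded P_def] z, where u = "1 + g ^ 2" and v = 0])
        (simp add: algebra_simps eval_nat_numeral)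
    then show ?thesis by blast
  qed
  have 3: ?thesis if "P True False True False"
  proof -
    have "D dvd 1 + g + g ^ 2 + g ^ 3"
      by (rule dvd_combination[OF that[unfolded P_def] z, where u = "1 + g" and v = 0])
        (simp add: algebra_simps eval_nat_numeral)
    then show ?thesis by blast
  qed
  have 4: ?thesis if "P True True True False"
  proof -
    have g1: "D dvd g - 1"
      by (rule dvd_combination[OF that[unfolded P_def] z, where u = "- g * (g - 1)" and v = 1])
        (simp add: algebra_simps eval_nat_numeral)
    have "D dvd 3"
      by (rule dvd_combination[OF that[unfolded P_def] g1, where u = 1 and v = "- (g + 2)"])
        (simp add: algebra_simps eval_nat_numeral)
    then show ?thesis using dvd_three_and_pred[OF _ g1] by blast
  qed
  have 5: ?thesis if "P True True True True" using that by (simp add: P_def)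
  have r0: "P a b c d" using dv by (simp add: P_def)
  note r1 = rot[OF r0]
  note r2 = rot[OF r1]
  note r3 = rot[OF r2]
  show ?thesis
  proof (rule ccontr)
    assume contra: "\<not> ?thesis"
    show False using contra nz 1 2 3 4 5 r0 r1 r2 r3
      by (cases a; cases b; cases c; cases d; simp)
  qed
qed

text \<open>Seven nonzero patterns remain up to rotation. Patterns 11000 and 10100 give
  \<open>D dvd 2\<close> and 11110 gives \<open>D dvd 4\<close>, so the odd \<open>D\<close> is a
  unit; the patterns 11100 and 11010 with three digits 1 give divisors of both 3 and
  \<open>g - 1\<close>.\<close>

lemma dvd_digit_sum_5:
  fixes D g :: int and a b c d e :: bool
  assumes "even g" and z: "D dvd g ^ 5 - 1"
    and nz: "a \<or> b \<or> c \<or> d \<or> e"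
    and dv: "D dvd of_bool a + of_bool b * g + of_bool c * g ^ 2 + of_bool d * g ^ 3 + of_bool e * g ^ 4"
  shows "D dvd 1 + g + g ^ 2 + g ^ 3 + g ^ 4 \<or> D dvd 3 \<and> 3 dvd g - 1"
proof -
  have "odd (g ^ 5 - 1)" using \<open>even g\<close> by simp
  then have "odd D" using z dvd_trans by blast
  define P where "P a b c d e \<longleftrightarrow>
      D dvd of_bool a + of_bool b * g + of_bool c * g ^ 2 + of_bool d * g ^ 3 + of_bool e * g ^ 4"
    for a b c d e
  have rot: "P e a b c d" if "P a b c d e" for a b c d e
    unfolding P_def
    by (rule dvd_combination[OF that[unfolded P_def] z, where u = g and v = "- of_bool e"])
      (simp add: algebra_simps eval_nat_numeral)
  have pow2: ?thesis if "D dvd 2 ^ n" for n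
    using odd_dvd_power_2_imp_unit[OF \<open>odd D\<close> that] by blast
  have 1: ?thesis if "P True False False False False"
    using that by (simp add: P_def unit_imp_dvd)
  have 2: ?thesis if "P True True False False False"
    by (rule pow2[of 1], rule dvd_combination[OF that[unfolded P_def] z,
        where u = "1 - g + g ^ 2 - g ^ 3 + g ^ 4" and v = "- 1"])
      (simp add: algebra_simps eval_nat_numeral)
  have 3: ?thesis if "P True False True False False"
  proof -
    have g1: "D dvd g - 1"
      by (rule dvd_combination[OF that[unfolded P_def] z, where u = "g - g ^ 3" and v = 1])
        (simp add: algebra_simps eval_nat_numeral)
    show ?thesis
      by (rule pow2[of 1], rule dvd_combination[OF that[unfolded P_def] g1,
          where u = 1 and v = "- (g + 1)"])
        (simp add: algebra_simps eval_nat_numeral)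
  qed
  have 4: ?thesis if "P True True True False False"
  proof -
    \<comment> \<open>A Euclidean algorithm: reducing \<open>g ^ 5 - 1\<close> by
      \<open>1 + g + g ^ 2\<close> leaves \<open>g ^ 2 - 1\<close>, then \<open>g + 2\<close> and
      finally 3 appear as remainders.\<close>
    have "D dvd g ^ 2 - 1"
      by (rule dvd_combination[OF that[unfolded P_def] z, where u = "- (g ^ 2) * (g - 1)" and v = 1])
        (simp add: algebra_simps eval_nat_numeral)
    from that[unfolded P_def] this have g2: "D dvd g + 2"
      by (rule dvd_combination[where u = 1 and v = "- 1"])
        (simp add: algebra_simps eval_nat_numeral)
    from \<open>D dvd g ^ 2 - 1\<close> g2 have 3: "D dvd 3"
      by (rule dvd_combination[where u = 1 and v = "- (g - 2)"])
        (simp add: algebra_simps eval_nat_numeral)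
    have "D dvd g - 1"
      by (rule dvd_combination[OF g2 3, where u = 1 and v = "- 1"]) simp
    then show ?thesis using dvd_three_and_pred[OF 3] by blast
  qed
  have 5: ?thesis if "P True True False True False"
  proof -
    have "D dvd g - g ^ 2"
      by (rule dvd_combination[OF that[unfolded P_def] z, where u = "1 - g ^ 2" and v = 1])
        (simp add: algebra_simps eval_nat_numeral)
    \<comment> \<open>Modulo \<open>D\<close> the inverse of \<open>g\<close> is
      \<open>g ^ 4\<close>, so the factor \<open>g\<close> cancels from
      \<open>g - g ^ 2\<close>.\<close>
    from this z have g1: "D dvd g - 1"
      by (rule dvd_combination[where u = "- (g ^ 4)" and v = "1 - g"])
        (simp add: algebra_simps eval_nat_numeral)
    have "D dvd 3"
      by (rule dvd_combination[OF that[unfolded P_def] g1, where u = 1 and v = "- (g ^ 2 + g + 2)"])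
        (simp add: algebra_simps eval_nat_numeral)
    then show ?thesis using dvd_three_and_pred[OF _ g1] by blast
  qed
  have 6: ?thesis if "P True True True True False"
  proof -
    have g1: "D dvd g - 1"
      by (rule dvd_combination[OF that[unfolded P_def] z, where u = "- g * (g - 1)" and v = 1])
        (simp add: algebra_simps eval_nat_numeral)
    show ?thesis
      by (rule pow2[of 2], rule dvd_combination[OF that[unfolded P_def] g1,
          where u = 1 and v = "- (g ^ 2 + 2 * g + 3)"])
        (simp add: algebra_simps eval_nat_numeral)
  qed
  have 7: ?thesis if "P True True True True True" using that by (simp add: P_def)
  have r0: "P a b c d e" using dv by (simp add: P_def)
  note r1 = rot[OF r0]
  note r2 = rot[OF r1]
  note r3 = rot[OF r2]
  note r4 = rot[OF r3]
  show ?thesis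
  proof (rule ccontr)
    assume contra: "\<not> ?thesis"
    show False using contra nz 1 2 3 4 5 6 7 r0 r1 r2 r3 r4
      by (cases a; cases b; cases c; cases d; cases e; simp)
  qed
qed

text \<open>The characteristic function of \<open>S\<close> supplies the Boolean digits. For
  \<open>k = 1\<close> the sum is the repunit itself; for \<open>k = 2\<close> the single terms 1
  and \<open>g\<close> are units modulo \<open>D\<close>.\<close>

lemma dvd_digit_sum:
  fixes D g :: int and S :: "nat set"
  assumes k: "k \<in> {1..5}" and "even g" and S: "S \<subseteq> {..<k}" "S \<noteq> {}"
    and z: "D dvd g ^ k - 1" and dv: "D dvd (\<Sum>i\<in>S. g ^ i)"
  shows "D dvd (\<Sum>i<k. g ^ i) \<or> 4 \<le> k \<and> D dvd 3 \<and> 3 dvd g - 1"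
proof -
  have "(\<Sum>i\<in>S. g ^ i) = (\<Sum>i<k. of_bool (i \<in> S) * g ^ i)"
    using S(1) by (intro sum.mono_neutral_cong_left) auto
  with dv have dv: "D dvd (\<Sum>i<k. of_bool (i \<in> S) * g ^ i)" by simp
  obtain j where j: "j \<in> S" "j < k" using S by auto
  have sum_lt: "(\<Sum>i<1. f i) = f 0" "(\<Sum>i<2. f i) = f 0 + f 1" "(\<Sum>i<3. f i) = f 0 + f 1 + f 2"
    "(\<Sum>i<4. f i) = f 0 + f 1 + f 2 + f 3" "(\<Sum>i<5. f i) = f 0 + f 1 + f 2 + f 3 + f 4"
    for f :: "nat \<Rightarrow> int"
    by (simp_all add: eval_nat_numeral)
  from k consider "k = 1" | "k = 2" | "k = 3" | "k = 4" | "k = 5" by force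
  then show ?thesis
  proof cases
    case 1
    then show ?thesis using dv j by simp
  next
    case 2
    have "D dvd of_bool (0 \<in> S) + of_bool (1 \<in> S) * g" using dv 2 by (simp add: sum_lt)
    moreover have "D dvd 1" if "D dvd g"
      by (rule dvd_combination[OF that z, where u = g and v = "- 1"]) (simp add: 2 power2_eq_square)
    moreover have "j = 0 \<or> j = 1" using j 2 by auto
    ultimately have "D dvd 1 + g" using j by (cases "0 \<in> S"; cases "1 \<in> S") (auto simp: unit_imp_dvd)
    then show ?thesis using 2 by (simp add: sum_lt)
  next
    case 3
    have "j = 0 \<or> j = 1 \<or> j = 2" using j 3 by auto
    then have "0 \<in> S \<or> 1 \<in> S \<or> 2 \<in> S" using j by auto
    from dvd_digit_sum_3[OF \<open>even g\<close> _ this] show ?thesis using z dv 3 by (simp add: sum_lt)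
  next
    case 4
    have "j = 0 \<or> j = 1 \<or> j = 2 \<or> j = 3" using j 4 by auto
    then have "0 \<in> S \<or> 1 \<in> S \<or> 2 \<in> S \<or> 3 \<in> S" using j by auto
    from dvd_digit_sum_4[OF _ this] show ?thesis using z dv 4 by (simp add: sum_lt)
  next
    case 5
    have "j = 0 \<or> j = 1 \<or> j = 2 \<or> j = 3 \<or> j = 4" using j 5 by auto
    then have "0 \<in> S \<or> 1 \<in> S \<or> 2 \<in> S \<or> 3 \<in> S \<or> 4 \<in> S" using j by auto
    from dvd_digit_sum_5[OF \<open>even g\<close> _ this] show ?thesis using z dv 5 by (simp add: sum_lt)
  qed
qed

text \<open>With \<open>g ^ k - 1 = D m\<close>, the factor \<open>m\<close> cancels from the
  divisibility supplied by the cycle, so \<open>D\<close> divides a nonempty digit sum.\<close>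

lemma incomplete_cofactor:
  assumes g: "even g" "g \<ge> 4" and k: "k \<in> {1..5}" and inc: "incomplete_number g m"
    and D: "D * int m = int g ^ k - 1"
  shows "D dvd (\<Sum>i<k. int g ^ i) \<or> 4 \<le> k \<and> D dvd 3 \<and> 3 dvd int g - 1"
proof -
  have "1 < int g ^ k" using g k by (intro one_less_power) auto
  then have m: "m > 0" using D by (cases "m = 0") auto
  have "int m dvd int g ^ k - 1" using D by (metis dvd_triv_right)
  then obtain S where S: "S \<subseteq> {..<k}" "S \<noteq> {}"
      "int g ^ k - 1 dvd int m * (\<Sum>i\<in>S. int g ^ i)"
    using incomplete_imp_dvd_digit_sum[of g m k] g k m inc by auto
  then have "D dvd (\<Sum>i\<in>S. int g ^ i)" using m by (simp add: D[symmetric] mult.commute)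
  moreover have "D dvd int g ^ k - 1" by (simp add: D[symmetric])
  ultimately show ?thesis using dvd_digit_sum[OF k _ S(1,2)] g(1) by simp
qed

section \<open>Explicit nontrivial cycles\<close>

lemma incomplete_numberI:
  assumes "extreme_cycle g m xs ls" "xs \<noteq> [0]"
  shows "incomplete_number g m"
  using assms unfolding incomplete_number_def complete_number_def by blast

lemma incomplete_base_pred:
  assumes "g \<ge> 2"
  shows "incomplete_number g (g - 1)"
proof -
  have "extreme_cycle g (g - 1) [1] [int (g - 1)]"
    using assms by (simp add: extreme_cycle_iff)
  then show ?thesis by (rule incomplete_numberI) simp
qed

text \<open>Here \<open>(g ^ k - 1) x = m a\<close> becomes \<open>3 x = a\<close>, so the points
  are thirds of the rotations of a digit sum with three terms, 1110 or 11100. A sum of three powers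
  of \<open>g\<close> with exponents \<open>i\<close>, \<open>j\<close>, \<open>l\<close> has third
  \<open>u i + u j + u l + 1\<close>, where \<open>u n = (g ^ n - 1) / 3\<close>.\<close>

lemma incomplete_third_of_power_pred:
  assumes g: "g \<ge> 2" and k: "k \<in> {4, 5}" and dv: "3 dvd int g - 1"
    and m: "3 * int m = int g ^ k - 1"
  shows "incomplete_number g m"
proof -
  define u where "u n = (int g ^ n - 1) div 3" for n
  have u: "3 * u n = int g ^ n - 1" for n
    unfolding u_def using dv by (metis dvd_mult_div_cancel dvd_trans power_diff_1_eq dvd_triv_left)
  have g1: "int g = 3 * u 1 + 1" using u[of 1] by simp
  have step: "int g * u n = u (Suc n) - u 1" for n
  proof -
    have "3 * (int g * u n) = int g * (3 * u n)" by simp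
    also have "\<dots> = 3 * u (Suc n) - 3 * u 1" by (simp only: u) (simp add: algebra_simps)
    finally show ?thesis by linarith
  qed
  have "u 1 > 0" using g g1 by linarith
  \<comment> \<open>This growth separates the points of the cycles below, which have to be
    distinct.\<close>
  have dbl: "u (Suc n) \<ge> 2 * u n + 1" for n
  proof -
    have "2 * int g ^ n \<le> int g * int g ^ n" using g by (intro mult_right_mono) auto
    then show ?thesis using u[of n] u[of "Suc n"] by simp
  qed
  have ineq: "u 2 \<ge> 2 * u 1 + 1" "u 3 \<ge> 2 * u 2 + 1" "u 4 \<ge> 2 * u 3 + 1"
    using dbl[of 1] dbl[of 2] dbl[of 3] by (simp_all add: eval_nat_numeral)
  have steps: "int g * u 1 = u 2 - u 1" "int g * u 2 = u 3 - u 1" "int g * u 3 = u 4 - u 1"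
    "int g * u 4 = u 5 - u 1"
    using step[of 1] step[of 2] step[of 3] step[of 4] by (simp_all add: eval_nat_numeral)
  have mu: "int m = u k" using m u[of k] by simp
  from k consider "k = 4" | "k = 5" by auto
  then show ?thesis
  proof cases
    case 1
    let ?xs = "[u 1 + u 2 + 1, u 1 + u 3 + 1, u 2 + u 3 + 1, u 1 + u 2 + u 3 + 1]"
    have "extreme_cycle g m ?xs [int m, int m, int m, 0]"
      using g ineq \<open>u 1 > 0\<close> steps g1 mu 1
      by (auto simp: extreme_cycle_iff less_Suc_eq distrib_left)
    then show ?thesis by (rule incomplete_numberI) simp
  next
    case 2
    let ?xs = "[u 1 + u 2 + 1, u 1 + u 4 + 1, u 3 + u 4 + 1, u 2 + u 3 + u 4 + 1, u 1 + u 2 + u 3 + 1]"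
    have "extreme_cycle g m ?xs [int m, int m, int m, 0, 0]"
      using g ineq \<open>u 1 > 0\<close> steps g1 mu 2
      by (auto simp: extreme_cycle_iff less_Suc_eq distrib_left)
    then show ?thesis by (rule incomplete_numberI) simp
  qed
qed

section \<open>Multiplicative orders\<close>

lemma cong_power_1_iff:
  fixes g m k :: nat
  shows "[g ^ k = 1] (mod m) \<longleftrightarrow> int m dvd int g ^ k - 1"
proof -
  have "[g ^ k = 1] (mod m) \<longleftrightarrow> [int (g ^ k) = int 1] (mod int m)" by (simp only: cong_int_iff)
  then show ?thesis by (simp add: cong_iff_dvd_diff)
qed

text \<open>An order \<open>j < k\<close> would give \<open>m \<le> g ^ j - 1\<close>, whereas
  \<open>3 m = g ^ k - 1 \<ge> 4 g ^ j - 1\<close>.\<close>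

lemma ord_third_of_power_pred:
  fixes g m k :: nat
  assumes g: "g \<ge> 4" and k: "0 < k" and m: "3 * int m = int g ^ k - 1"
  shows "ord m g = k"
proof -
  let ?j = "ord m g"
  have "int m dvd int g ^ k - 1" using m by (metis dvd_triv_right)
  then have "?j dvd k" by (simp only: flip: cong_power_1_iff ord_divides)
  then have j: "0 < ?j" "?j \<le> k" using k by (auto dest: dvd_imp_le intro: dvd_pos_nat)
  have "int m dvd int g ^ ?j - 1" using ord[of g m] by (simp only: cong_power_1_iff)
  moreover have "1 < int g ^ ?j" using g j by (intro one_less_power) auto
  ultimately have le: "int m \<le> int g ^ ?j - 1" by (intro zdvd_imp_le) auto
  show ?thesis
  proof (rule ccontr)
    assume "?j \<noteq> k"
    then have "Suc ?j \<le> k" using j by simp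
    then have "int g ^ Suc ?j \<le> int g ^ k" using g by (intro power_increasing) auto
    moreover have "4 * int g ^ ?j \<le> int g ^ Suc ?j" using g by simp
    ultimately show False using m le \<open>1 < int g ^ ?j\<close> by linarith
  qed
qed

lemma ord_base_pred:
  fixes g :: nat
  assumes "g \<ge> 2"
  shows "ord (g - 1) g = 1"
proof -
  have "[g ^ 1 = 1] (mod (g - 1))" using assms by (subst cong_power_1_iff) simp
  then show ?thesis by (simp add: ord_eq_Suc_0_iff)
qed

section \<open>Primitive numbers of order at most 5\<close>

text \<open>If the cofactor \<open>D\<close> divides the repunit, then \<open>m\<close> is a
  multiple of the incomplete number \<open>g - 1\<close>, hence equal to it by primitivity.
  Otherwise \<open>D dvd 3\<close>; the value 1 falls under the first case and 3 gives the other
  candidate.\<close>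

lemma primitive_order_le_5_cases:
  assumes g: "even g" "g \<ge> 4" and k: "k \<in> {1..5}"
    and prim: "primitive_number g m" and ord_m: "ord m g = k"
  shows "m = g - 1 \<and> k = 1 \<or> 4 \<le> k \<and> 3 dvd g - 1 \<and> m = (g ^ k - 1) div 3"
proof -
  let ?N = "\<Sum>i<k. int g ^ i"
  have inc: "incomplete_number g m" using prim by (simp add: primitive_number_def)
  have "int m dvd int g ^ k - 1" using ord[of g m] ord_m by (simp only: flip: cong_power_1_iff)
  then obtain D where D: "D * int m = int g ^ k - 1" by (metis dvdE mult.commute)
  have gk: "1 < int g ^ k" using g k by (intro one_less_power) auto
  then have "D * int m > 0" using D by simp
  then have "D > 0" by (simp add: zero_less_mult_iff)
  have repunit: ?thesis if rep: "D dvd ?N"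
  proof -
    obtain c where c: "?N = D * c" using rep by blast
    have "D * int m = D * ((int g - 1) * c)"
      using D c power_diff_1_eq[of "int g" k] by (simp add: algebra_simps)
    then have "int m = int (g - 1) * c" using \<open>D > 0\<close> g(2) by simp
    then have "g - 1 dvd m" by (metis dvd_triv_left int_dvd_int_iff)
    then have "m = g - 1"
      using prim incomplete_base_pred[of g] g(2) unfolding primitive_number_def incomplete_number_def by auto
    then show ?thesis using ord_base_pred[of g] ord_m g(2) by simp
  qed
  from incomplete_cofactor[OF g k inc D] show ?thesis
  proof
    assume *: "4 \<le> k \<and> D dvd 3 \<and> 3 dvd int g - 1"
    then have "D \<le> 3" by (intro zdvd_imp_le) auto
    moreover have "D \<noteq> 2" using * by auto
    ultimately consider "D = 1" | "D = 3" using \<open>D > 0\<close> by linarith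
    then show ?thesis
    proof cases
      case 1
      then show ?thesis using repunit by simp
    next
      case 2
      moreover have "1 \<le> g ^ k" using g(2) by simp
      ultimately have "int (3 * m) = int (g ^ k - 1)" using D by simp
      then have "3 * m = g ^ k - 1" by (simp only: of_nat_eq_iff)
      moreover have "int 3 dvd int (g - 1)" using * g(2) by simp
      then have "3 dvd g - 1" by (simp only: int_dvd_int_iff)
      ultimately show ?thesis using * by auto
    qed
  qed (rule repunit)
qed

text \<open>For minimality, an incomplete divisor \<open>d = m / c\<close> has cofactor
  \<open>3 c\<close>. This cannot divide the repunit, which is congruent to \<open>k\<close> modulo
  3 with \<open>k\<close> equal to 4 or 5; so \<open>3 c\<close> divides 3 and
  \<open>d = m\<close>.\<close>

lemma primitive_third_of_power_pred:
  assumes g: "even g" "g \<ge> 4" and k: "k \<in> {4, 5}" and dv: "3 dvd g - 1"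
  shows "primitive_number g ((g ^ k - 1) div 3) \<and> ord ((g ^ k - 1) div 3) g = k"
proof -
  define m where "m = (g ^ k - 1) div 3"
  have gk: "1 < g ^ k" using g k by (intro one_less_power) auto
  have "int 3 dvd int (g - 1)" using dv by (simp only: int_dvd_int_iff)
  then have dv3: "3 dvd int g - 1" using g(2) by simp
  have pow: "3 dvd int g ^ i - 1" for i
    using dv3 by (metis dvd_trans power_diff_1_eq dvd_triv_left)
  have "int 3 dvd int (g ^ k - 1)" using pow[of k] gk by simp
  then have "3 dvd g ^ k - 1" by (simp only: int_dvd_int_iff)
  then have "3 * m = g ^ k - 1" by (simp add: m_def)
  then have "int (3 * m) = int (g ^ k - 1)" by (simp only:)
  then have m: "3 * int m = int g ^ k - 1" using gk by simp
  have "odd (g ^ k - 1)" using g k gk by auto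
  then have "odd m" using \<open>3 * m = g ^ k - 1\<close> by (metis dvd_mult)
  have inc: "incomplete_number g m" using incomplete_third_of_power_pred[OF _ k dv3 m] g(2) by simp
  have "complete_number g d" if d: "d dvd m" "d \<noteq> m" for d
  proof (rule ccontr)
    assume "\<not> complete_number g d"
    then have inc: "incomplete_number g d" by (simp add: incomplete_number_def)
    obtain c where c: "m = d * c" using d(1) by blast
    have "3 * int c * int d = int g ^ k - 1" using m c by (simp add: mult_ac)
    moreover have "k \<in> {1..5}" using k by auto
    ultimately have "3 * int c dvd (\<Sum>i<k. int g ^ i) \<or> 3 * int c dvd 3"
      using incomplete_cofactor[OF g _ inc] by blast
    then show False
    proof
      assume "3 * int c dvd (\<Sum>i<k. int g ^ i)"
      then have "3 dvd (\<Sum>i<k. int g ^ i)" by (rule dvd_mult_left)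
      moreover have "3 dvd (\<Sum>i<k. int g ^ i - 1)" using pow by (intro dvd_sum) auto
      then have "3 dvd (\<Sum>i<k. int g ^ i) - int k" by (simp add: sum_subtractf)
      ultimately have "3 dvd (\<Sum>i<k. int g ^ i) - ((\<Sum>i<k. int g ^ i) - int k)"
        by (rule dvd_diff)
      then have "3 dvd int k" by simp
      then show False using k by auto
    next
      assume "3 * int c dvd 3"
      then have "c = 1" by simp
      then show False using c d(2) by simp
    qed
  qed
  then have "primitive_number g m" using \<open>odd m\<close> inc by (simp add: primitive_number_def)
  moreover have "ord m g = k" using ord_third_of_power_pred[OF g(2) _ m] k by auto
  ultimately show ?thesis by (simp add: m_def)
qed

text \<open>For \<open>k = 1\<close> the repunit is 1, so an incomplete divisor of
  \<open>g - 1\<close> has cofactor 1.\<close>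

lemma primitive_base_pred:
  assumes g: "even g" "g \<ge> 4"
  shows "primitive_number g (g - 1) \<and> ord (g - 1) g = 1"
proof -
  have "complete_number g d" if d: "d dvd g - 1" "d \<noteq> g - 1" for d
  proof (rule ccontr)
    assume "\<not> complete_number g d"
    then have inc: "incomplete_number g d" by (simp add: incomplete_number_def)
    obtain c where c: "g - 1 = d * c" using d(1) by blast
    then have "int (g - 1) = int c * int d" by simp
    then have "int c * int d = int g ^ 1 - 1" using g(2) by simp
    from incomplete_cofactor[OF g _ inc this] have "c = 1" by simp
    then show False using c d(2) by simp
  qed
  moreover have "odd (g - 1)" using g by auto
  ultimately have "primitive_number g (g - 1)"
    using incomplete_base_pred[of g] g(2) by (simp add: primitive_number_def)
  then show ?thesis using ord_base_pred[of g] g(2) by simp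
qed

theorem theorem4p1:
  fixes g :: nat
  assumes "even g" and "g \<ge> 4"
  shows "{m. primitive_number g m \<and> ord m g = 1} = {g - 1}
    \<and> {m. primitive_number g m \<and> ord m g = 2} = {}
    \<and> {m. primitive_number g m \<and> ord m g = 3} = {}
    \<and> (\<not> 3 dvd (g - 1) \<longrightarrow>
         {m. primitive_number g m \<and> ord m g = 4} = {}
       \<and> {m. primitive_number g m \<and> ord m g = 5} = {})
    \<and> (3 dvd (g - 1) \<longrightarrow>
         {m. primitive_number g m \<and> ord m g = 4} = {(g ^ 4 - 1) div 3}
       \<and> {m. primitive_number g m \<and> ord m g = 5} = {(g ^ 5 - 1) div 3})"
proof -
  note imp = primitive_order_le_5_cases[OF assms]
  have "{m. primitive_number g m \<and> ord m g = 1} = {g - 1}"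
    using imp[of 1] primitive_base_pred[OF assms] by auto
  \<comment> \<open>Orders 2 and 3 fit neither alternative: one requires \<open>k = 1\<close>, the
    other \<open>4 \<le> k\<close>.\<close>
  moreover have "{m. primitive_number g m \<and> ord m g = 2} = {}"
    "{m. primitive_number g m \<and> ord m g = 3} = {}"
    using imp[of 2] imp[of 3] by auto
  moreover have "{m. primitive_number g m \<and> ord m g = k} = {}"
    if "\<not> 3 dvd g - 1" "k \<in> {4, 5}" for k
    using imp[of k] that by auto
  moreover have "{m. primitive_number g m \<and> ord m g = k} = {(g ^ k - 1) div 3}"
    if "3 dvd g - 1" "k \<in> {4, 5}" for k
    using imp[of k] primitive_third_of_power_pred[OF assms that(2,1)] that by auto
  ultimately show ?thesis by simp
qed

end
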